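(* For $a\in\mathbb{N}_0$, define $$\log A_{-1}(a):=\lim_{n\to\infty}\left\{\sum_{k=1}^{n}\frac{\log k}{k+a}-\frac{1}{2}\log^2 n\right\}.$$ Then $$D(1,1;0)=\sum_{l=1}^{\infty}(-1)^l\zeta'(l+1)=\log A_{-1}(0)-\log A_{-1}(1).$$ Equivalently, $$A_{-1}(a)=\lim_{n\to\infty}\frac{1}{n^{\log\sqrt{n}}}\prod_{k=1}^{n}k^{1/(k+a)},\qquad e^{D(1,1;0)}=\prod_{n=1}^{\infty}n^{\frac{1}{n}-\frac{1}{n+1}} .$$
   Context: $\mathbb{N}_0=\{0,1,2,\dots\}$, $\zeta$ is the Riemann zeta function and $\zeta'$ its derivative. For $s_1,s_2\in\mathbb{C}$ with $s_1\notin\mathbb{Z}_{\le 0}$ and $\lambda\in\mathbb{C}$ with $\lambda\notin\mathbb{Z}_{<0}$, $$D(s_1,s_2;\lambda):=\sum_{k=1}^{\infty}\frac{\zeta(s_1+k)-1}{(k+\lambda)^{s_2}},$$ so that $D(1,1;0)=\sum_{k=1}^{\infty}\frac{\zeta(k+1)-1}{k}$. Here $\log^2 n=(\log n)^2$. *)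

theory Defs
  imports "HOL-Complex_Analysis.Complex_Analysis"
begin

definition zeta_series :: "complex \<Rightarrow> complex" where
  "zeta_series s = (\<Sum>n. 1 / of_nat (Suc n) powr s)"

(* The Dirichlet series on Re s > 1, and elsewhere its analytic continuation to the plane without 1.
   Any two functions satisfying the condition under SOME agree at every s \<noteq> 1 by the identity
   theorem; the value at the pole s = 1 is unspecified. *)
definition zeta :: "complex \<Rightarrow> complex" where
  "zeta s = (if Re s > 1 then zeta_series s
     else (SOME f. f holomorphic_on - {1} \<and> (\<forall>w. Re w > 1 \<longrightarrow> f w = zeta_series w)) s)"

(* Meant for s1 not in {0, -1, -2, ...} and l not in {-1, -2, ...}, which keeps the summands away
   from the pole of zeta and from division by 0.  The power is the principal one. *)
definition zeta_D :: "complex \<Rightarrow> complex \<Rightarrow> complex \<Rightarrow> complex" where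
  "zeta_D s1 s2 l = (\<Sum>k. (zeta (s1 + of_nat (Suc k)) - 1) / (of_nat (Suc k) + l) powr s2)"

definition log_A_seq :: "nat \<Rightarrow> nat \<Rightarrow> real" where
  "log_A_seq a n = (\<Sum>k=1..n. ln (real k) / (real k + real a)) - 1/2 * (ln (real n))\<^sup>2"

definition log_A :: "nat \<Rightarrow> real" where
  "log_A a = lim (log_A_seq a)"

definition A_const :: "nat \<Rightarrow> real" where
  "A_const a = exp (log_A a)"

end

theory Submission
  imports Defs "HOL-Real_Asymp.Real_Asymp"
begin

text \<open>
  Expanding each zeta value, or derivative of zeta, as a Dirichlet series turns either series into
  an absolutely convergent double series.  Summing it first over the exponent gives, for each
  \<open>n \<ge> 2\<close>, \<open>(ln n - ln (n - 1)) / n\<close> by the logarithmic series and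
  \<open>ln n / (n (n + 1))\<close> by the geometric series.  Abel summation identifies the two sums over \<open>n\<close>,
  and \<open>ln n / (n (n + 1)) = ln n / n - ln n / (n + 1)\<close> is the \<open>n\<close>-th term of the
  sequence defining \<open>log_A 0 - log_A 1\<close>.
\<close>

section \<open>Interchange of summation\<close>

text \<open>Fubini for series: the row sums \<open>A\<close> of the norms are summable, so
  \<open>f\<close> is summable over all pairs and may be summed in either order. \<open>A\<close> is
  kept apart from \<open>R\<close> because the two differ when the terms change sign.\<close>

lemma sums_swap:
  fixes f :: "nat \<Rightarrow> nat \<Rightarrow> 'a :: banach"
  assumes rows: "\<And>n. (\<lambda>k. f n k) sums R n"
    and cols: "\<And>k. (\<lambda>n. f n k) sums C k"
    and norms: "\<And>n. (\<lambda>k. norm (f n k)) sums A n"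
    and A: "summable A"
    and R: "R sums s"
  shows "C sums s"
proof -
  \<comment> \<open>A bound independent of \<open>k\<close>, so \<open>A\<close> also dominates
    every column.\<close>
  have nle: "norm (f n k) \<le> A n" for n k
    using sum_le_suminf[of "\<lambda>k. norm (f n k)" "{k}"] norms[of n] by (auto simp: sums_iff)
  have A0: "A n \<ge> 0" for n
    using nle[of n 0] norm_ge_zero order_trans by blast
  have "(\<lambda>x. norm (case x of (n, k) \<Rightarrow> f n k)) summable_on UNIV \<times> UNIV"
  proof (rule summable_on_SigmaI)
    show "((\<lambda>k. norm (case (n, k) of (n, k) \<Rightarrow> f n k)) has_sum A n) UNIV" for n
      using norms[of n] by (simp add: sums_nonneg_imp_has_sum)
    show "A summable_on UNIV"
      using A A0 by (rule summable_nonneg_imp_summable_on)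
  qed auto
  hence summ: "(\<lambda>(n, k). f n k) summable_on UNIV \<times> UNIV"
    by (rule abs_summable_summable)
  \<comment> \<open>Absolute convergence of \<open>R\<close> turns its ordered sum \<open>s\<close>
    into an unordered one.\<close>
  have "norm (R n) \<le> A n" for n
  proof -
    have "norm (\<Sum>k. f n k) \<le> (\<Sum>k. norm (f n k))"
      using norms[of n] by (intro summable_norm) (simp add: sums_iff)
    thus ?thesis
      using rows[of n] norms[of n] by (simp add: sums_iff)
  qed
  hence "summable (\<lambda>n. norm (R n))"
    using A by (intro summable_comparison_test'[OF A]) auto
  hence R': "(R has_sum s) UNIV"
    using R by (rule norm_summable_imp_has_sum)
  have "((\<lambda>(n, k). f n k) has_sum s) (UNIV \<times> UNIV)"
  proof (rule has_sum_SigmaI[OF _ R' summ])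
    show "((\<lambda>k. case (n, k) of (n, k) \<Rightarrow> f n k) has_sum R n) UNIV" for n
      using norm_summable_imp_has_sum[OF _ rows[of n]] norms[of n] by (simp add: sums_iff)
  qed
  hence "((\<lambda>(k, n). f n k) has_sum s) (UNIV \<times> UNIV)"
    by (subst (asm) has_sum_swap) (simp add: case_prod_unfold)
  hence "(C has_sum s) UNIV"
  proof (rule has_sum_SigmaD)
    fix k :: nat
    have "summable (\<lambda>n. norm (f n k))"
      using nle by (intro summable_comparison_test'[OF A]) auto
    thus "((\<lambda>n. case (k, n) of (k, n) \<Rightarrow> f n k) has_sum C k) UNIV"
      using norm_summable_imp_has_sum[OF _ cols[of k]] by simp
  qed
  thus ?thesis
    by (rule has_sum_imp_sums)
qed

section \<open>The Dirichlet series of zeta and its derivative\<close>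

text \<open>The Dirichlet series has a uniform summable majorant on a half-plane around
  \<open>s\<close>, so it may be differentiated term by term there.\<close>

lemma zeta_sums_and_deriv_zeta_sums:
  assumes s: "Re s > 1"
  shows "(\<lambda>n. 1 / of_nat (Suc n) powr s) sums zeta s"
    and "(\<lambda>n. - of_real (ln (real (Suc n))) / of_nat (Suc n) powr s) sums deriv zeta s"
proof -
  \<comment> \<open>The gap on the right makes \<open>S\<close> an open neighbourhood of
    \<open>s\<close>; the gap on the left makes the majorant \<open>h\<close> summable.\<close>
  obtain c where c: "1 < c" "c < Re s"
    using s dense by blast
  define S where "S = {z. Re z > c}"
  have S: "open S" "s \<in> S"
    using c by (auto simp: S_def open_halfspace_Re_gt)
  define h where "h = (\<lambda>n. real (Suc n) powr - c)"
  have h: "summable h"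
    unfolding h_def using c summable_real_powr_iff[of "-c"] by (subst summable_Suc_iff) simp
  have deriv: "((\<lambda>z. 1 / of_nat (Suc n) powr z) has_field_derivative
      - of_real (ln (real (Suc n))) / of_nat (Suc n) powr z) (at z)" for n and z :: complex
  proof -
    have "Ln (of_nat (Suc n)) = of_real (ln (real (Suc n)))"
      by (metis Ln_of_real of_nat_0_less_iff of_real_of_nat_eq zero_less_Suc)
    hence D: "((\<lambda>z. of_nat (Suc n) powr z) has_field_derivative
        of_real (ln (real (Suc n))) * of_nat (Suc n) powr z) (at z)"
      using has_field_derivative_powr_right[of "of_nat (Suc n)" z] by (simp del: of_nat_Suc)
    \<comment> \<open>The left side is the shape in which \<open>DERIV_inverse'\<close> gives the
      derivative of a reciprocal.\<close>
    have "- (inverse w * (c * w) * inverse w) = - c / w" if "w \<noteq> 0" for c w :: complex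
      using that by (simp add: divide_inverse)
    moreover have "of_nat (Suc n) powr z \<noteq> 0"
      by (simp del: of_nat_Suc)
    ultimately show ?thesis
      using DERIV_inverse'[OF D] by (simp only: inverse_eq_divide not_False_eq_True simp_thms)
  qed
  have bound: "norm (1 / of_nat (Suc n) powr z :: complex) \<le> h n" if "z \<in> S" for n z
  proof -
    have "norm (of_nat (Suc n) powr z) = real (Suc n) powr Re z"
      by (subst norm_powr_real_powr) auto
    moreover have "real (Suc n) powr c \<le> real (Suc n) powr Re z"
      using that by (intro powr_mono) (auto simp: S_def)
    ultimately show ?thesis
      by (simp add: norm_divide h_def powr_minus field_simps del: of_nat_Suc)
  qed
  have ev: "\<forall>\<^sub>F n in sequentially. \<forall>z\<in>S. norm (1 / of_nat (Suc n) powr z :: complex) \<le> h n"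
    using bound by (intro always_eventually) blast
  obtain g g' where "\<forall>z\<in>S. (\<lambda>n. 1 / of_nat (Suc n) powr z) sums g z \<and>
      (\<lambda>n. - of_real (ln (real (Suc n))) / of_nat (Suc n) powr z) sums g' z \<and>
      (g has_field_derivative g' z) (at z)"
    by (rule series_and_derivative_comparison[OF S(1) h deriv ev])
  hence gg': "\<And>z. z \<in> S \<Longrightarrow> (\<lambda>n. 1 / of_nat (Suc n) powr z) sums g z"
      "\<And>z. z \<in> S \<Longrightarrow> (\<lambda>n. - of_real (ln (real (Suc n))) / of_nat (Suc n) powr z) sums g' z"
      "\<And>z. z \<in> S \<Longrightarrow> (g has_field_derivative g' z) (at z)"
    by blast+
  \<comment> \<open>As \<open>Re z > c > 1\<close>, only the Dirichlet series branch of
    \<open>zeta\<close> matters here, not the \<open>SOME\<close> branch.\<close>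
  have zeta: "zeta z = g z" if "z \<in> S" for z
    using gg'(1)[OF that] that c by (simp add: zeta_def zeta_series_def S_def sums_iff)
  have "(zeta has_field_derivative g' s) (at s)"
    by (rule has_field_derivative_transform_within_open[OF gg'(3)[OF S(2)] S]) (simp add: zeta)
  thus "(\<lambda>n. - of_real (ln (real (Suc n))) / of_nat (Suc n) powr s) sums deriv zeta s"
    using gg'(2)[OF S(2)] by (simp add: DERIV_imp_deriv)
  show "(\<lambda>n. 1 / of_nat (Suc n) powr s) sums zeta s"
    using gg'(1)[OF S(2)] zeta[OF S(2)] by simp
qed

text \<open>The subtracted 1 is the first Dirichlet term, so the bases start at 2.\<close>

lemma zeta_of_nat_minus_1_sums:
  assumes "m \<ge> 2"
  shows "(\<lambda>n. of_real (1 / real (n + 2) ^ m)) sums (zeta (of_nat m) - 1)"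
proof -
  have "(\<lambda>n. 1 / of_nat (Suc n) powr of_nat m) sums zeta (of_nat m)"
    using assms by (intro zeta_sums_and_deriv_zeta_sums) simp
  hence "(\<lambda>n. of_real (1 / real (Suc n) ^ m)) sums zeta (of_nat m)"
    by (simp add: powr_nat' del: of_nat_Suc)
  from sums_split_initial_segment[OF this, of 1] show ?thesis
    by simp
qed

text \<open>Since \<open>ln 1 = 0\<close>, starting at base 2 leaves the sum unchanged.\<close>

lemma deriv_zeta_of_nat_sums:
  assumes "m \<ge> 2"
  shows "(\<lambda>n. of_real (- ln (real (n + 2)) / real (n + 2) ^ m)) sums deriv zeta (of_nat m)"
proof -
  have "(\<lambda>n. - of_real (ln (real (Suc n))) / of_nat (Suc n) powr of_nat m) sums deriv zeta (of_nat m)"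
    using assms by (intro zeta_sums_and_deriv_zeta_sums) simp
  hence "(\<lambda>n. of_real (- ln (real (Suc n)) / real (Suc n) ^ m)) sums deriv zeta (of_nat m)"
    by (simp add: powr_nat' del: of_nat_Suc)
  from sums_split_initial_segment[OF this, of 1] show ?thesis
    by simp
qed

section \<open>The constants \<open>log_A a\<close>\<close>

text \<open>The leading parts \<open>ln n / n\<close> of the increments cancel, leaving order
  \<open>ln n / n^2\<close>; hence the telescoping series converges and the \<open>lim\<close> in
  \<open>log_A\<close> is a genuine limit.\<close>

lemma log_A_seq_LIMSEQ: "log_A_seq a \<longlonglongrightarrow> log_A a"
proof -
  have "summable (\<lambda>n. log_A_seq a (Suc n) - log_A_seq a n)"
  proof (rule summable_comparison_test_bigo)
    \<comment> \<open>The exponent \<open>-3/2\<close> lies between \<open>-2\<close> and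
      \<open>-1\<close>: it absorbs the logarithm and is still summable.\<close>
    show "summable (\<lambda>n. norm (real n powr (-3/2)))"
      by (simp add: summable_real_powr_iff)
    have "log_A_seq a (Suc n) - log_A_seq a n = ln (real n + 1) / (real n + 1 + real a) -
        1/2 * (ln (real n + 1) - ln (real n)) * (ln (real n + 1) + ln (real n))" for n
      by (simp add: log_A_seq_def power2_eq_square field_simps)
    moreover have "(\<lambda>n. ln (real n + 1) / (real n + 1 + real a) -
          1/2 * (ln (real n + 1) - ln (real n)) * (ln (real n + 1) + ln (real n)))
        \<in> O(\<lambda>n. real n powr (-3/2))"
      by real_asymp
    ultimately show "(\<lambda>n. log_A_seq a (Suc n) - log_A_seq a n) \<in> O(\<lambda>n. real n powr (-3/2))"
      by simp
  qed
  hence "convergent (\<lambda>n. log_A_seq a n - log_A_seq a 0)"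
    by (simp add: summable_iff_convergent sum_lessThan_telescope)
  \<comment> \<open>This rests on the convention \<open>ln 0 = 0\<close>.\<close>
  moreover have "log_A_seq a 0 = 0"
    by (simp add: log_A_seq_def)
  ultimately have "convergent (log_A_seq a)"
    by simp
  thus ?thesis
    by (simp add: log_A_def convergent_LIMSEQ_iff)
qed

text \<open>By partial fractions the partial sums are exactly
  \<open>log_A_seq 0 n - log_A_seq 1 n\<close>; the squared logarithms cancel.\<close>

lemma log_A_diff_sums:
  "(\<lambda>n. ln (real n + 1) / ((real n + 1) * (real n + 2))) sums (log_A 0 - log_A 1)"
proof -
  have "(\<Sum>i<n. ln (real i + 1) / ((real i + 1) * (real i + 2))) = log_A_seq 0 n - log_A_seq 1 n" for n
  proof (induction n)
    case (Suc n)
    have "ln (real n + 1) / ((real n + 1) * (real n + 2)) =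
        ln (real n + 1) / (real n + 1) - ln (real n + 1) / (real n + 2)"
      by (simp add: divide_simps) (simp add: algebra_simps)
    with Suc show ?case
      by (simp add: log_A_seq_def add_ac)
  qed (simp add: log_A_seq_def)
  thus ?thesis
    unfolding sums_def by (simp add: tendsto_diff log_A_seq_LIMSEQ)
qed

text \<open>The dropped term contains \<open>ln 1 = 0\<close>. This indexing matches the double
  series, whose bases start at 2.\<close>

lemma log_A_diff_sums_from_2:
  "(\<lambda>n. ln (real n + 2) / ((real n + 2) * (real n + 3))) sums (log_A 0 - log_A 1)"
  using sums_split_initial_segment[OF log_A_diff_sums, of 1] by (simp add: add_ac)

text \<open>Abel summation moves the difference from the logarithms to the reciprocals; the boundary
  term \<open>ln (n + 1) / (n + 1)\<close> tends to 0.\<close>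

lemma ln_diff_sums:
  "(\<lambda>n. (ln (real n + 2) - ln (real n + 1)) / (real n + 2)) sums (log_A 0 - log_A 1)"
proof -
  have eq: "(\<Sum>i<n. (ln (real i + 2) - ln (real i + 1)) / (real i + 2)) =
     (\<Sum>i<n. ln (real i + 1) / ((real i + 1) * (real i + 2))) + ln (real n + 1) / (real n + 1)" for n
  proof (induction n)
    case (Suc n)
    have "(ln (real n + 2) - ln (real n + 1)) / (real n + 2) + ln (real n + 1) / (real n + 1) =
        ln (real n + 1) / ((real n + 1) * (real n + 2)) + ln (real n + 2) / (real n + 2)"
      by (simp add: divide_simps) (simp add: algebra_simps)
    with Suc show ?case
      by (simp add: add_ac)
  qed simp
  have "(\<lambda>n. ln (real n + 1) / (real n + 1)) \<longlonglongrightarrow> 0"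
    by real_asymp
  from tendsto_add[OF log_A_diff_sums[unfolded sums_def] this] show ?thesis
    unfolding sums_def eq by simp
qed

section \<open>The two series\<close>

text \<open>All terms of the double series are positive, so the same row sums serve as
  \<open>R\<close> and as \<open>A\<close> in \<open>sums_swap\<close>.\<close>

lemma zeta_minus_1_over_sums:
  "(\<lambda>k. (zeta (of_nat (k + 2)) - 1) / of_nat (Suc k)) sums of_real (log_A 0 - log_A 1)"
proof (rule sums_swap)
  define f where "f = (\<lambda>n k. 1 / real (n + 2) ^ (k + 2) / real (Suc k))"
  have row: "f n sums ((ln (real n + 2) - ln (real n + 1)) / (real n + 2))" for n
  proof -
    \<comment> \<open>The row is \<open>x\<close> times the logarithmic series for
      \<open>- ln (1 - x)\<close>.\<close>
    define x where "x = 1 / (real n + 2)"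
    have "(\<lambda>k. - ((- (-x)) ^ k) / of_nat k) sums ln (1 + -x)"
      by (rule ln_series') (simp add: x_def)
    hence "(\<lambda>k. x ^ k / of_nat k) sums (- ln (1 - x))"
      using sums_minus by fastforce
    \<comment> \<open>The dropped term at \<open>k = 0\<close> is a division by zero, hence
      0.\<close>
    hence "(\<lambda>k. x ^ Suc k / of_nat (Suc k)) sums (- ln (1 - x))"
      using sums_split_initial_segment[of _ _ 1] by fastforce
    hence "(\<lambda>k. x * (x ^ Suc k / of_nat (Suc k))) sums (x * (- ln (1 - x)))"
      by (rule sums_mult)
    moreover have "1 - x = (real n + 1) / (real n + 2)"
      by (simp add: x_def field_simps)
    hence "x * (- ln (1 - x)) = (ln (real n + 2) - ln (real n + 1)) / (real n + 2)"
      by (simp add: ln_div x_def)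
    moreover have "x * (x ^ Suc k / of_nat (Suc k)) = f n k" for k
      by (simp add: f_def x_def power_divide add.commute[of 2])
    ultimately show ?thesis
      by simp
  qed
  show "(\<lambda>k. complex_of_real (f n k)) sums
      of_real ((ln (real n + 2) - ln (real n + 1)) / (real n + 2))" for n
    using row by (rule sums_of_real)
  show "(\<lambda>k. norm (complex_of_real (f n k))) sums
      ((ln (real n + 2) - ln (real n + 1)) / (real n + 2))" for n
  proof -
    have "norm (complex_of_real (f n k)) = f n k" for k
      unfolding norm_of_real by (simp add: f_def)
    thus ?thesis using row by simp
  qed
  show "summable (\<lambda>n. (ln (real n + 2) - ln (real n + 1)) / (real n + 2))"
    using ln_diff_sums by (rule sums_summable)
  show "(\<lambda>n. complex_of_real ((ln (real n + 2) - ln (real n + 1)) / (real n + 2)))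
      sums of_real (log_A 0 - log_A 1)"
    using ln_diff_sums by (rule sums_of_real)
  show "(\<lambda>n. complex_of_real (f n k)) sums ((zeta (of_nat (k + 2)) - 1) / of_nat (Suc k))" for k
    using sums_divide[OF zeta_of_nat_minus_1_sums[of "k + 2"], of "of_nat (Suc k)"]
    by (simp add: f_def del: of_nat_Suc of_nat_add)
qed

text \<open>The rows are geometric with ratio \<open>-x\<close>, where
  \<open>x = 1 / (n + 2)\<close>; their norms have ratio \<open>x\<close>, so \<open>n + 3\<close>
  in the row sum becomes \<open>n + 1\<close> in the majorant.\<close>

lemma alternating_deriv_zeta_sums:
  "(\<lambda>k. (-1) ^ Suc k * deriv zeta (of_nat (k + 2))) sums of_real (log_A 0 - log_A 1)"
proof (rule sums_swap)
  define f where "f = (\<lambda>n k. (-1) ^ Suc k * (- ln (real (n + 2)) / real (n + 2) ^ (k + 2)))"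
  show "(\<lambda>k. complex_of_real (f n k)) sums
      of_real (ln (real n + 2) / ((real n + 2) * (real n + 3)))" for n
  proof (rule sums_of_real)
    define x where "x = 1 / (real n + 2)"
    have "(\<lambda>k. (-x) ^ k) sums (1 / (1 - (-x)))"
      by (rule geometric_sums) (simp add: x_def)
    hence "(\<lambda>k. ln (real n + 2) * x\<^sup>2 * (-x) ^ k) sums (ln (real n + 2) * x\<^sup>2 * (1 / (1 - (-x))))"
      by (rule sums_mult)
    moreover have "ln (real n + 2) * x\<^sup>2 * (1 / (1 - (-x))) =
        ln (real n + 2) / ((real n + 2) * (real n + 3))"
      by (simp add: x_def divide_simps power2_eq_square)
    moreover have "ln (real n + 2) * x\<^sup>2 * (-x) ^ k = f n k" for k
      by (subst power_minus) (simp add: f_def x_def power_divide power2_eq_square mult_ac add.commute[of 2])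
    ultimately show "f n sums (ln (real n + 2) / ((real n + 2) * (real n + 3)))"
      by simp
  qed
  show "(\<lambda>k. norm (complex_of_real (f n k))) sums
      (ln (real n + 2) / ((real n + 2) * (real n + 1)))" for n
  proof -
    define x where "x = 1 / (real n + 2)"
    have "(\<lambda>k. x ^ k) sums (1 / (1 - x))"
      by (rule geometric_sums) (simp add: x_def)
    hence "(\<lambda>k. ln (real n + 2) * x\<^sup>2 * x ^ k) sums (ln (real n + 2) * x\<^sup>2 * (1 / (1 - x)))"
      by (rule sums_mult)
    moreover have "ln (real n + 2) * x\<^sup>2 * (1 / (1 - x)) =
        ln (real n + 2) / ((real n + 2) * (real n + 1))"
      by (simp add: x_def divide_simps power2_eq_square)
    moreover have "ln (real n + 2) * x\<^sup>2 * x ^ k = norm (complex_of_real (f n k))" for k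
      unfolding norm_of_real
      by (simp add: f_def x_def power_divide add_ac power2_eq_square abs_mult power_abs)
    ultimately show ?thesis
      by simp
  qed
  show "summable (\<lambda>n. ln (real n + 2) / ((real n + 2) * (real n + 1)))"
  proof (rule summable_comparison_test_bigo)
    show "summable (\<lambda>n. norm (real n powr (-3/2)))"
      by (simp add: summable_real_powr_iff)
    show "(\<lambda>n. ln (real n + 2) / ((real n + 2) * (real n + 1))) \<in> O(\<lambda>n. real n powr (-3/2))"
      by real_asymp
  qed
  show "(\<lambda>n. complex_of_real (ln (real n + 2) / ((real n + 2) * (real n + 3))))
      sums of_real (log_A 0 - log_A 1)"
    using log_A_diff_sums_from_2 by (rule sums_of_real)
  show "(\<lambda>n. complex_of_real (f n k)) sums ((-1) ^ Suc k * deriv zeta (of_nat (k + 2)))" for k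
    using sums_mult[OF deriv_zeta_of_nat_sums[of "k + 2"], of "(-1) ^ Suc k"]
    by (simp add: f_def del: of_nat_Suc of_nat_add)
qed

section \<open>Product forms\<close>

lemma A_const_LIMSEQ:
  "(\<lambda>n. 1 / real n powr ln (sqrt (real n)) *
     (\<Prod>k=1..n. real k powr (1 / (real k + real a)))) \<longlonglongrightarrow> A_const a"
proof -
  have "(\<lambda>n. exp (log_A_seq a n)) \<longlonglongrightarrow> A_const a"
    unfolding A_const_def by (intro tendsto_exp log_A_seq_LIMSEQ)
  moreover have "eventually (\<lambda>n. exp (log_A_seq a n) = 1 / real n powr ln (sqrt (real n)) *
     (\<Prod>k=1..n. real k powr (1 / (real k + real a)))) sequentially"
    \<comment> \<open>The identity fails at \<open>n = 0\<close>, where \<open>0 powr 0 = 0\<close>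
      makes the right side 0.\<close>
    using eventually_gt_at_top[of 0]
  proof eventually_elim
    case (elim n)
    have "(\<Prod>k=1..n. real k powr (1 / (real k + real a))) =
        exp (\<Sum>k=1..n. ln (real k) / (real k + real a))"
      unfolding exp_sum[OF finite_atLeastAtMost] by (intro prod.cong) (auto simp: powr_def)
    moreover have "real n powr ln (sqrt (real n)) = exp (1/2 * (ln (real n))\<^sup>2)"
      using elim by (simp add: powr_def ln_sqrt power2_eq_square)
    ultimately show ?case
      by (simp add: log_A_seq_def exp_diff)
  qed
  ultimately show ?thesis
    by (rule Lim_transform_eventually)
qed

lemma has_prod_exp_log_A_diff:
  "(\<lambda>n. complex_of_real (real (Suc n) powr (1 / real (Suc n) - 1 / (real (Suc n) + 1))))
     has_prod exp (complex_of_real (log_A 0 - log_A 1))"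
proof -
  have "real (Suc n) powr (1 / real (Suc n) - 1 / (real (Suc n) + 1)) =
      exp (ln (real n + 1) / ((real n + 1) * (real n + 2)))" for n
    by (simp add: powr_def add_ac) (simp add: field_simps)
  moreover have "(\<lambda>n. exp (complex_of_real (ln (real n + 1) / ((real n + 1) * (real n + 2)))))
      has_prod exp (complex_of_real (log_A 0 - log_A 1))"
    \<comment> \<open>The exponential factors never vanish, so the disjunct of
      \<open>has_prod\<close> with nonzero limit applies.\<close>
    unfolding has_prod_def
    using sums_imp_has_prod_exp[OF sums_of_real[OF log_A_diff_sums]] by blast
  ultimately show ?thesis
    by (simp only: exp_of_real)
qed

theorem theorem2p4:
  shows "(\<forall>a. log_A_seq a \<longlonglongrightarrow> log_A a) \<and>
    (\<lambda>k. (zeta (of_nat (Suc k) + 1) - 1) / of_nat (Suc k)) sums zeta_D 1 1 0 \<and>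
    (\<lambda>l. (-1) ^ Suc l * deriv zeta (of_nat (Suc l) + 1)) sums zeta_D 1 1 0 \<and>
    zeta_D 1 1 0 = complex_of_real (log_A 0 - log_A 1) \<and>
    (\<forall>a. (\<lambda>n. 1 / real n powr ln (sqrt (real n)) *
             (\<Prod>k=1..n. real k powr (1 / (real k + real a)))) \<longlonglongrightarrow> A_const a) \<and>
    (\<lambda>n. complex_of_real (real (Suc n) powr (1 / real (Suc n) - 1 / (real (Suc n) + 1))))
       has_prod exp (zeta_D 1 1 0)"
proof -
  \<comment> \<open>Reconciles summation from 1, written with \<open>Suc\<close>, with the arguments
    \<open>k + 2\<close> of the two series lemmas.\<close>
  have arg: "of_nat (Suc k) + 1 = (of_nat (k + 2) :: complex)" for k
    by simp
  have D: "zeta_D 1 1 0 = complex_of_real (log_A 0 - log_A 1)"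
  proof -
    have "zeta_D 1 1 0 = (\<Sum>k. (zeta (of_nat (k + 2)) - 1) / of_nat (Suc k))"
      unfolding zeta_D_def arg[symmetric] by (simp add: add_ac del: of_nat_Suc)
    thus ?thesis
      using zeta_minus_1_over_sums by (simp only: sums_iff)
  qed
  show ?thesis
    unfolding D arg
    using log_A_seq_LIMSEQ zeta_minus_1_over_sums alternating_deriv_zeta_sums A_const_LIMSEQ
      has_prod_exp_log_A_diff by blast
qed

end
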